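(* Let $q\in\mathbb{C}$ with $0<|q|<1$, let $n\ge0$ be an integer and let $k$ be an integer with $0\le k\le\frac{n+1}{2}$. Then $$\mathcal{T}_{n+2}^{k}(x,s,q)=x\,\mathcal{U}_{n+1}^{k}(x,q^{2}s,q)+qs\,\mathcal{U}_{n}^{k-1}(x,q^{2}s,q),$$ where $\mathcal{T}_m^k$ and $\mathcal{U}_m^k$ are the incomplete $q$-Chebyshev polynomials of the first and second kind.
   Context: Notation: $[n]_q=\frac{1-q^n}{1-q}$, $[0]_q=0$; $(a;q)_0=1$ and $(a;q)_n=\prod_{i=0}^{n-1}(1-q^i a)$; $\begin{bmatrix} n\\k\end{bmatrix}_q=\frac{(q;q)_n}{(q;q)_{n-k}(q;q)_k}$ for $0\le k\le n$, and it is $0$ for $n<k$. Here $x,s$ are indeterminates. For a nonnegative integer $n$ and $0\le k\le\lfloor n/2\rfloor$, the incomplete $q$-Chebyshev polynomials of the second kind are $$\mathcal{U}_n^k(x,s,q)=\sum_{j=0}^{k}q^{j^2}\begin{bmatrix} n-j\\ j\end{bmatrix}_q\frac{(-q;q)_{n-j}}{(-q;q)_j}\,s^jx^{n-2j},$$ with $\mathcal{U}_n^{-1}=0$ (empty sum); $\mathcal{U}_n^k(x,q^2s,q)$ is obtained by replacing $s$ with $q^2s$. For $n\ge1$ and $0\le k\le\lfloor n/2\rfloor$, the incomplete $q$-Chebyshev polynomials of the first kind are $$\mathcal{T}_n^k(x,s,q)=\sum_{j=0}^{k}q^{j^2}\frac{[n]_q}{[n-j]_q}\begin{bmatrix} n-j\\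 j\end{bmatrix}_q\frac{(-q;q)_{n-j-1}}{(-q;q)_j}\,s^jx^{n-2j}.$$ *)

theory Defs
  imports Complex_Main "HOL-Computational_Algebra.Polynomial"
begin

definition q_number :: "nat \<Rightarrow> complex \<Rightarrow> complex" where
  "q_number n q = (1 - q ^ n) / (1 - q)"

definition q_pochhammer :: "complex \<Rightarrow> complex \<Rightarrow> nat \<Rightarrow> complex" where
  "q_pochhammer a q n = (\<Prod>i<n. 1 - q ^ i * a)"

definition q_binomial :: "nat \<Rightarrow> nat \<Rightarrow> complex \<Rightarrow> complex" where
  "q_binomial n k q =
     (if k \<le> n then q_pochhammer q q n / (q_pochhammer q q (n - k) * q_pochhammer q q k) else 0)"

text \<open>
  The ring \<open>\<complex>[s][x]\<close> of polynomials in two indeterminates is represented by the type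
  \<^typ>\<open>complex poly poly\<close>: the outer variable is \<open>x\<close>, the inner one is \<open>s\<close>.
\<close>

definition X :: "complex poly poly" where
  "X = [:0, 1:]"

definition S :: "complex poly poly" where
  "S = [:[:0, 1:]:]"

definition const :: "complex \<Rightarrow> complex poly poly" where
  "const c = [:[:c:]:]"

text \<open>
  The upper index is an integer so that \<open>-1\<close> is allowed, where the sum is empty. The polynomials
  of the second kind are meant for \<open>-1 \<le> k \<le> \<lfloor>n/2\<rfloor>\<close>, those of the first kind for \<open>n \<ge> 1\<close>
  and \<open>0 \<le> k \<le> \<lfloor>n/2\<rfloor>\<close>; there all subtractions on \<^typ>\<open>nat\<close> below are exact.
\<close>

definition incomplete_q_chebyshev_U ::
    "nat \<Rightarrow> int \<Rightarrow> complex poly poly \<Rightarrow> complex poly poly \<Rightarrow> complex \<Rightarrow> complex poly poly" where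
  "incomplete_q_chebyshev_U n k x s q =
     (\<Sum>j\<in>{j::nat. int j \<le> k}.
        const (q ^ (j\<^sup>2) * q_binomial (n - j) j q
                 * (q_pochhammer (- q) q (n - j) / q_pochhammer (- q) q j))
        * s ^ j * x ^ (n - 2 * j))"

definition incomplete_q_chebyshev_T ::
    "nat \<Rightarrow> int \<Rightarrow> complex poly poly \<Rightarrow> complex poly poly \<Rightarrow> complex \<Rightarrow> complex poly poly" where
  "incomplete_q_chebyshev_T n k x s q =
     (\<Sum>j\<in>{j::nat. int j \<le> k}.
        const (q ^ (j\<^sup>2) * (q_number n q / q_number (n - j) q) * q_binomial (n - j) j q
                 * (q_pochhammer (- q) q (n - j - 1) / q_pochhammer (- q) q j))
        * s ^ j * x ^ (n - 2 * j))"

end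

theory Submission
  imports Defs
begin

text \<open>
  The identity holds coefficientwise. After the summation index of the second sum is shifted by
  one, both sides are combinations of the same monomials \<open>s\<^sup>j x\<^bsup>n + 2 - 2 * j\<^esup>\<close>. With
  \<open>m = n + 1 - j\<close>, the coefficients share the factor \<open>q\<^bsup>j * j\<^esup> (-q; q)\<^sub>m / (-q; q)\<^sub>j\<close>. For \<open>j = 0\<close>
  the remaining factors are all \<open>1\<close>; for \<open>j \<ge> 1\<close> what remains, writing \<open>C(a, b)\<close> for the
  \<open>q\<close>-binomial coefficient, is the Pascal-type rule of lemma \<open>q_binomial_weighted_pascal\<close>:

  \<open>[m + 1 + j] / [m + 1] * C(m + 1, j) = q\<^bsup>2 * j\<^esup> C(m, j) + (1 + q\<^sup>j) C(m, j - 1)\<close>.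

  Since \<open>C(m, j) = C(m + 1, j) [m + 1 - j] / [m + 1]\<close> and
  \<open>C(m, j - 1) = C(m + 1, j) [j] / [m + 1]\<close>, this reduces to
  \<open>1 - q\<^bsup>m + 1 + j\<^esup> = q\<^bsup>2 * j\<^esup> (1 - q\<^bsup>m + 1 - j\<^esup>) + (1 + q\<^sup>j) (1 - q\<^sup>j)\<close>.
  The bound on \<open>k\<close> gives \<open>j \<le> m\<close> and makes all exponents of \<open>x\<close> exact; \<open>|q| < 1\<close> keeps all
  denominators away from \<open>0\<close>.
\<close>

lemma const_add: "const (a + b) = const a + const b"
  by (simp add: const_def)

lemma const_mult: "const (a * b) = const a * const b"
  by (simp add: const_def)

lemma const_power: "const (a ^ n) = const a ^ n"
  by (induction n) (simp_all only: power_0 power_Suc const_mult, simp add: const_def one_pCons)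

lemma q_pochhammer_Suc:
  "q_pochhammer a q (Suc n) = q_pochhammer a q n * (1 - q ^ n * a)"
  by (simp add: q_pochhammer_def)

lemma q_pochhammer_nonzero:
  assumes "norm q < 1" and "norm a < 1"
  shows "q_pochhammer a q n \<noteq> 0"
proof -
  have "1 - q ^ i * a \<noteq> 0" for i
  proof
    assume "1 - q ^ i * a = 0"
    then have "norm (q ^ i) * norm a = 1"
      by (metis eq_iff_diff_eq_0 norm_mult norm_one)
    moreover have "norm (q ^ i) * norm a \<le> norm a"
      using assms by (simp add: norm_power power_le_one mult_left_le_one_le)
    ultimately show False
      using assms by simp
  qed
  then show ?thesis
    by (simp add: q_pochhammer_def)
qed

lemma one_minus_power_nonzero:
  fixes q :: complex
  assumes "norm q < 1"
  shows "1 - q ^ Suc n \<noteq> 0"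
  using q_pochhammer_nonzero[OF assms assms, of "Suc n"]
  by (simp add: q_pochhammer_Suc mult.commute)

lemma q_binomial_0:
  assumes "norm q < 1"
  shows "q_binomial n 0 q = 1"
  using q_pochhammer_nonzero[OF assms assms, of n]
  by (simp add: q_binomial_def) (simp add: q_pochhammer_def)

text \<open>
  The Pascal-type rule for \<open>j \<ge> 1\<close>, with \<open>j = i + 1\<close> and \<open>m = i + 1 + d\<close>, so that no natural
  number subtraction occurs.
\<close>

lemma q_binomial_weighted_pascal:
  assumes q: "norm q < 1"
  shows "q_number (2 * i + d + 3) q / q_number (i + d + 2) q * q_binomial (i + d + 2) (i + 1) q
    = q ^ (2 * (i + 1)) * q_binomial (i + d + 1) (i + 1) q
      + (1 + q ^ (i + 1)) * q_binomial (i + d + 1) i q"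
proof -
  define P where "P = q_pochhammer q q"
  have P_Suc: "P (Suc n) = P n * (1 - q ^ Suc n)" for n
    by (simp add: P_def q_pochhammer_Suc mult.commute)
  have nz: "P n \<noteq> 0" "1 - q ^ Suc n \<noteq> 0" for n
    using q_pochhammer_nonzero[OF q q] one_minus_power_nonzero[OF q] by (auto simp: P_def)
  have q1: "1 - q \<noteq> 0"
    using nz(2)[of 0] by simp
  define A where "A = P (i + d + 1)"
  define B where "B = P i"
  define C where "C = P d"
  define u where "u = 1 - q ^ Suc i"
  define v where "v = 1 - q ^ Suc d"
  define w where "w = 1 - q ^ (i + d + 2)"
  have w0: "w \<noteq> 0"
    using nz(2)[of "i + d + 1"] by (simp add: w_def)
  have ne: "A \<noteq> 0" "B \<noteq> 0" "C \<noteq> 0" "u \<noteq> 0" "v \<noteq> 0"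
    unfolding A_def B_def C_def u_def v_def by (rule nz)+
  have PS: "P (i + 1) = B * u" "P (d + 1) = C * v" "P (i + d + 2) = A * w"
    using P_Suc[of i] P_Suc[of d] P_Suc[of "i + d + 1"]
    by (simp_all add: A_def B_def C_def u_def v_def w_def)
  have b1: "q_binomial (i + d + 2) (i + 1) q = A * w / (C * v * (B * u))"
    using PS by (simp add: q_binomial_def P_def [symmetric])
  have b2: "q_binomial (i + d + 1) (i + 1) q = A / (C * (B * u))"
    using PS by (simp add: q_binomial_def P_def [symmetric] A_def C_def)
  have b3: "q_binomial (i + d + 1) i q = A / (C * v * B)"
    using PS by (simp add: q_binomial_def P_def [symmetric] A_def B_def)
  have num: "q_number (2 * i + d + 3) q / q_number (i + d + 2) q
      = (1 - q ^ (2 * i + d + 3)) / w"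
    using q1 by (simp add: q_number_def w_def)
  have key: "1 - q ^ (2 * i + d + 3) = q ^ (2 * (i + 1)) * v + (1 + q ^ (i + 1)) * u"
  proof -
    have "2 * i + d + 3 = Suc i + Suc i + Suc d" "2 * (i + 1) = Suc i + Suc i" "i + 1 = Suc i"
      by simp_all
    then show ?thesis
      unfolding u_def v_def by (simp only: power_add) (simp add: algebra_simps)
  qed
  show ?thesis
    unfolding num b1 b2 b3 key using ne w0 by (simp add: divide_simps) (simp add: algebra_simps)
qed

theorem theorem6:
  fixes q :: complex and n :: nat and k :: int
  assumes "0 < norm q" and "norm q < 1"
    and "0 \<le> k" and "real_of_int k \<le> (real n + 1) / 2"
  shows "incomplete_q_chebyshev_T (n + 2) k X S q =
           X * incomplete_q_chebyshev_U (n + 1) k X (const (q\<^sup>2) * S) q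
           + const q * S * incomplete_q_chebyshev_U n (k - 1) X (const (q\<^sup>2) * S) q"
proof -
  note q = assms(2)
  obtain K where K: "k = int K"
    using assms(3) nonneg_int_cases by blast
  have K_le: "2 * K \<le> n + 1"
    using assms(4) unfolding K by simp
  have sets: "{j::nat. int j \<le> k} = {..K}" "{j::nat. int j \<le> k - 1} = {..<K}"
    by (auto simp: K)
  define t where "t j = const (q ^ (j\<^sup>2) * (q_number (n + 2) q / q_number (n + 2 - j) q)
      * q_binomial (n + 2 - j) j q
      * (q_pochhammer (- q) q (n + 2 - j - 1) / q_pochhammer (- q) q j))
      * S ^ j * X ^ (n + 2 - 2 * j)" for j
  define u where "u n j = const (q ^ (j\<^sup>2) * q_binomial (n - j) j q
      * (q_pochhammer (- q) q (n - j) / q_pochhammer (- q) q j))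
      * (const (q\<^sup>2) * S) ^ j * X ^ (n - 2 * j)" for n j
  have T: "incomplete_q_chebyshev_T (n + 2) k X S q = t 0 + (\<Sum>i<K. t (Suc i))"
    unfolding incomplete_q_chebyshev_T_def sets t_def [symmetric] by (rule sum.atMost_shift)
  have U1: "incomplete_q_chebyshev_U (n + 1) k X (const (q\<^sup>2) * S) q
      = u (n + 1) 0 + (\<Sum>i<K. u (n + 1) (Suc i))"
    unfolding incomplete_q_chebyshev_U_def sets u_def [symmetric] by (rule sum.atMost_shift)
  have U2: "incomplete_q_chebyshev_U n (k - 1) X (const (q\<^sup>2) * S) q = (\<Sum>i<K. u n i)"
    unfolding incomplete_q_chebyshev_U_def sets u_def ..
  have zero: "t 0 = X * u (n + 1) 0"
  proof -
    have "q_number (n + 2) q \<noteq> 0"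
      using one_minus_power_nonzero[OF q, of "n + 1"] one_minus_power_nonzero[OF q, of 0]
      by (simp add: q_number_def)
    then show ?thesis
      using q_binomial_0[OF q] by (simp add: t_def u_def mult_ac)
  qed
  have step: "t (Suc i) = X * u (n + 1) (Suc i) + const q * S * u n i" if "i < K" for i
  proof -
    \<comment> \<open>The bound \<open>2 * K \<le> n + 1\<close> makes this subtraction exact.\<close>
    define d where "d = n - 2 * i - 1"
    have n: "n = 2 * i + d + 1"
      using that K_le by (simp add: d_def)
    define F where "F = q_pochhammer (- q) q (i + d + 1)"
    define G where "G = q_pochhammer (- q) q (Suc i)"
    define N where "N = q_number (2 * i + d + 3) q / q_number (i + d + 2) q"
    define b1 where "b1 = q_binomial (i + d + 2) (i + 1) q"
    define b2 where "b2 = q_binomial (i + d + 1) (i + 1) q"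
    define b3 where "b3 = q_binomial (i + d + 1) i q"
    have G: "G = q_pochhammer (- q) q i * (1 + q ^ (i + 1))" "G \<noteq> 0"
      using q_pochhammer_nonzero[of q "- q" "Suc i"] q
      by (simp add: G_def q_pochhammer_Suc mult.commute) (simp add: G_def q_pochhammer_nonzero q)
    then have "1 + q ^ (i + 1) \<noteq> 0"
      by (metis mult_zero_right)
    then have FG: "F / q_pochhammer (- q) q i = (1 + q ^ (i + 1)) * (F / G)"
      unfolding G(1) by (simp del: power_Suc add: add.commute)
    have t: "t (Suc i)
        = const (q ^ (Suc i)\<^sup>2 * N * b1 * (F / G)) * S ^ Suc i * X ^ Suc d"
      by (simp add: t_def n F_def G_def N_def b1_def eval_nat_numeral)
    have u1: "X * u (n + 1) (Suc i)
        = const (q ^ (Suc i)\<^sup>2 * (q ^ (2 * (i + 1)) * b2) * (F / G)) * S ^ Suc i * X ^ Suc d"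
    proof -
      have "u (n + 1) (Suc i)
          = const (q ^ (Suc i)\<^sup>2 * b2 * (F / G)) * (const (q\<^sup>2) * S) ^ Suc i * X ^ d"
        by (simp add: u_def n F_def G_def b2_def)
      also have "(const (q\<^sup>2) * S) ^ Suc i = const (q ^ (2 * (i + 1))) * S ^ Suc i"
        by (simp only: power_mult_distrib const_power [symmetric] power_mult Suc_eq_plus1)
      finally show ?thesis
        by (simp only: const_mult power_Suc mult_ac)
    qed
    have u2: "const q * S * u n i
        = const (q ^ (Suc i)\<^sup>2 * ((1 + q ^ (i + 1)) * b3) * (F / G)) * S ^ Suc i * X ^ Suc d"
    proof -
      have "u n i = const (q ^ i\<^sup>2 * b3 * ((1 + q ^ (i + 1)) * (F / G)))
          * (const (q\<^sup>2) * S) ^ i * X ^ Suc d"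
        unfolding FG [symmetric] by (simp add: u_def n F_def b3_def)
      also have "(const (q\<^sup>2) * S) ^ i = const (q ^ (2 * i)) * S ^ i"
        by (simp only: power_mult_distrib const_power [symmetric] power_mult)
      finally have "const q * S * u n i
          = const (q * q ^ (2 * i) * q ^ i\<^sup>2) * const ((1 + q ^ (i + 1)) * b3 * (F / G))
            * S ^ Suc i * X ^ Suc d"
        by (simp only: const_mult power_Suc mult_ac)
      also have "q * q ^ (2 * i) * q ^ i\<^sup>2 = q ^ (Suc i)\<^sup>2"
      proof -
        have "(Suc i)\<^sup>2 = Suc (2 * i + i\<^sup>2)"
          by (simp add: power2_eq_square)
        then show ?thesis
          by (simp only: power_Suc power_add mult.assoc)
      qed
      finally show ?thesis
        by (simp only: const_mult mult_ac)
    qed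
    have pascal: "N * b1 = q ^ (2 * (i + 1)) * b2 + (1 + q ^ (i + 1)) * b3"
      unfolding N_def b1_def b2_def b3_def by (rule q_binomial_weighted_pascal[OF q])
    show ?thesis
      unfolding t u1 u2 mult.assoc[of _ N b1] pascal
      by (simp only: distrib_left distrib_right const_add)
  qed
  show ?thesis
    unfolding T U1 U2 zero
    by (simp add: step sum.distrib sum_distrib_left distrib_left add.assoc)
qed

end
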